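(* For a set $A\subseteq\omega$ the following statements are equivalent: (1) $A$ is complex. (2) $A$ is hyperavoidable.
   Context: Fix an acceptable numbering $\varphi_0,\varphi_1,\dots$ of the partial recursive functions. $C$ denotes plain Kolmogorov complexity with respect to a fixed universal machine on binary strings. $A\upharpoonright y$ is the binary string $A(0)\ldots A(y-1)$. An order function is a function $g:\omega\to\omega$ that is recursive, nondecreasing and unbounded. A set $A$ is complex if there is an order function $g$ with $C(A\upharpoonright y)\ge g(y)$ for all $y$. A set $A$ is hyperavoidable if there is an order function $h$ such that for all $x$ with $\{0,1,\ldots,h(x)-1\}\subseteq\{y:\varphi_x(y)\text{ is defined and lies in }\{0,1\}\}$ we have $A\upharpoonright h(x)\ne\varphi_x\upharpoonright h(x)$. In other words, for every $x$ there is $y<h(x)$ such that $\varphi_x(y)$ is undefined or $\varphi_x(y)\neq A(y)$. *)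

theory Defs
  imports Main
begin

text \<open>
  Unbounded search: undefined if there is no zero, or if some value before the first zero is
  undefined.
\<close>
definition mu :: "(nat \<rightharpoonup> nat) \<Rightarrow> nat option" where
  "mu f = (if \<exists>n. f n = Some 0 \<and> (\<forall>m<n. f m \<noteq> None) then Some (LEAST n. f n = Some 0) else None)"

text \<open>
  A partial function of \<open>k\<close> arguments is represented by a function on argument lists, of which
  only the values on lists of length \<open>k\<close> matter (rule \<open>ext\<close>).  Composition is strict: it is
  undefined as soon as one of the inner functions is.
\<close>
inductive partial_recursive :: "nat \<Rightarrow> (nat list \<rightharpoonup> nat) \<Rightarrow> bool" where
  zero: "partial_recursive k (\<lambda>_. Some 0)"
| succ: "partial_recursive 1 (\<lambda>xs. Some (Suc (hd xs)))"
| proj: "i < k \<Longrightarrow> partial_recursive k (\<lambda>xs. Some (xs ! i))"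
| comp: "partial_recursive (length gs) f \<Longrightarrow> \<forall>g\<in>set gs. partial_recursive k g \<Longrightarrow>
    partial_recursive k
      (\<lambda>xs. if \<exists>g\<in>set gs. g xs = None then None else f (map (\<lambda>g. the (g xs)) gs))"
| prim_rec: "partial_recursive k f \<Longrightarrow> partial_recursive (Suc (Suc k)) g \<Longrightarrow>
    partial_recursive (Suc k)
      (\<lambda>xs. rec_nat (f (tl xs)) (\<lambda>n r. Option.bind r (\<lambda>y. g (n # y # tl xs))) (hd xs))"
| minimization: "partial_recursive (Suc k) f \<Longrightarrow>
    partial_recursive k (\<lambda>xs. mu (\<lambda>n. f (n # xs)))"
| ext: "partial_recursive k f \<Longrightarrow> (\<And>xs. length xs = k \<Longrightarrow> f xs = g xs) \<Longrightarrow> partial_recursive k g"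

definition partial_recursive1 :: "(nat \<rightharpoonup> nat) \<Rightarrow> bool" where
  "partial_recursive1 \<psi> \<longleftrightarrow> partial_recursive 1 (\<lambda>xs. \<psi> (xs ! 0))"

definition partial_recursive2 :: "(nat \<Rightarrow> nat \<rightharpoonup> nat) \<Rightarrow> bool" where
  "partial_recursive2 \<psi> \<longleftrightarrow> partial_recursive 2 (\<lambda>xs. \<psi> (xs ! 0) (xs ! 1))"

definition recursive :: "(nat \<Rightarrow> nat) \<Rightarrow> bool" where
  "recursive f \<longleftrightarrow> partial_recursive1 (\<lambda>x. Some (f x))"

text \<open>
  An acceptable numbering is a uniformly partial recursive one to which every other such
  numbering is reducible by a recursive translation of indices.  That every partial recursive
  function then has an index is shown in \<open>acceptable_numbering_surj\<close> below.
\<close>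
definition acceptable_numbering :: "(nat \<Rightarrow> nat \<rightharpoonup> nat) \<Rightarrow> bool" where
  "acceptable_numbering \<phi> \<longleftrightarrow> partial_recursive2 \<phi> \<and>
    (\<forall>\<psi>. partial_recursive2 \<psi> \<longrightarrow> (\<exists>f. recursive f \<and> (\<forall>x. \<phi> (f x) = \<psi> x)))"

lemma acceptable_numbering_surj:
  assumes "acceptable_numbering \<phi>" and "partial_recursive1 \<psi>"
  shows "\<exists>x. \<phi> x = \<psi>"
proof -
  have "partial_recursive (length [\<lambda>xs :: nat list. Some (xs ! 1)]) (\<lambda>xs. \<psi> (xs ! 0))"
    using assms(2) by (simp add: partial_recursive1_def)
  moreover have "\<forall>g\<in>set [\<lambda>xs :: nat list. Some (xs ! 1)]. partial_recursive 2 g"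
    by (auto intro: partial_recursive.proj)
  ultimately have "partial_recursive2 (\<lambda>_. \<psi>)"
    unfolding partial_recursive2_def
    by (rule partial_recursive.ext[OF partial_recursive.comp]) simp
  with assms(1) show ?thesis
    unfolding acceptable_numbering_def by blast
qed

text \<open>
  Binary strings are numbered in length-lexicographic order: \<open>w\<close> gets the number \<open>n\<close> such that
  \<open>1w\<close> is the binary notation of \<open>n + 1\<close>, most significant digit first.
\<close>
definition string_code :: "bool list \<Rightarrow> nat" where
  "string_code w = foldl (\<lambda>n b. 2 * n + 1 + of_bool b) 0 w"

lemma bij_string_code: "bij string_code"
proof (rule bijI)
  have "string_code v = string_code w \<Longrightarrow> v = w" for v w
  proof (induction v arbitrary: w rule: rev_induct)
    case Nil
    then show ?case
      by (cases w rule: rev_cases) (auto simp: string_code_def)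
  next
    case (snoc b v)
    obtain w' c where w: "w = w' @ [c]"
      using snoc.prems by (cases w rule: rev_cases) (auto simp: string_code_def)
    have eq: "2 * string_code v + of_bool b = 2 * string_code w' + of_bool c"
      using snoc.prems by (simp add: w string_code_def)
    then have "b = c"
      by (cases b; cases c) (auto, presburger+)
    with eq snoc.IH show ?case
      by (simp add: w)
  qed
  then show "inj string_code"
    by (rule injI)
next
  have "\<exists>w. string_code w = n" for n
  proof (induction n rule: less_induct)
    case (less n)
    show ?case
    proof (cases n)
      case 0
      then show ?thesis
        by (auto simp: string_code_def intro: exI[of _ "[]"])
    next
      case (Suc m)
      then obtain w where "string_code w = m div 2"
        using less.IH[of "m div 2"] by (metis div_le_dividend le_imp_less_Suc)
      then have "string_code (w @ [odd m]) = n"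
        using Suc by (simp add: string_code_def)
      then show ?thesis ..
    qed
  qed
  then show "surj string_code"
    by (metis surjI)
qed

definition machine :: "(bool list \<rightharpoonup> bool list) \<Rightarrow> bool" where
  "machine M \<longleftrightarrow>
    (\<exists>\<psi>. partial_recursive1 \<psi> \<and> (\<forall>p. \<psi> (string_code p) = map_option string_code (M p)))"

text \<open>
  Universality is required in its weakest usual form.  Machines that simulate \<open>M\<close> on the program
  \<open>\<tau>p\<close>, for a prefix \<open>\<tau>\<close> depending only on \<open>M\<close>, are included, with \<open>c = length \<tau>\<close>.
\<close>
definition universal_machine :: "(bool list \<rightharpoonup> bool list) \<Rightarrow> bool" where
  "universal_machine U \<longleftrightarrow> machine U \<and>
    (\<forall>M. machine M \<longrightarrow>
      (\<exists>c. \<forall>p\<in>dom M. \<exists>q. U q = M p \<and> length q \<le> length p + c))"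

text \<open>
  For universal \<open>U\<close> every string has a program, by \<open>universal_machine_surj\<close> below, so that the
  minimum exists.
\<close>
definition plain_complexity :: "(bool list \<rightharpoonup> bool list) \<Rightarrow> bool list \<Rightarrow> nat" where
  "plain_complexity U w = (LEAST n. \<exists>p. U p = Some w \<and> length p = n)"

lemma universal_machine_surj:
  assumes "universal_machine U"
  shows "\<exists>p. U p = Some w"
proof -
  have "partial_recursive1 Some"
    unfolding partial_recursive1_def by (rule partial_recursive.proj) simp
  then have "machine Some"
    unfolding machine_def by (intro exI[of _ Some]) simp
  with assms show ?thesis
    unfolding universal_machine_def by fastforce
qed

definition initial_segment :: "nat set \<Rightarrow> nat \<Rightarrow> bool list"  (infixl "\<restriction>" 90) where
  "A \<restriction> n = map (\<lambda>i. i \<in> A) [0..<n]"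

definition order_function :: "(nat \<Rightarrow> nat) \<Rightarrow> bool" where
  "order_function g \<longleftrightarrow> recursive g \<and> mono g \<and> (\<forall>b. \<exists>x. b \<le> g x)"

definition complex_set :: "(bool list \<rightharpoonup> bool list) \<Rightarrow> nat set \<Rightarrow> bool" where
  "complex_set U A \<longleftrightarrow>
    (\<exists>g. order_function g \<and> (\<forall>y. g y \<le> plain_complexity U (A \<restriction> y)))"

text \<open>
  Where \<open>\<phi> x\<close> is defined with values in \<open>{0, 1}\<close>, it is the characteristic function of
  \<open>{y. \<phi> x y = Some 1}\<close>.
\<close>
definition hyperavoidable :: "(nat \<Rightarrow> nat \<rightharpoonup> nat) \<Rightarrow> nat set \<Rightarrow> bool" where
  "hyperavoidable \<phi> A \<longleftrightarrow>
    (\<exists>h. order_function h \<and>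
      (\<forall>x. {..<h x} \<subseteq> {y. \<phi> x y \<in> {Some 0, Some 1}} \<longrightarrow>
        A \<restriction> h x \<noteq> {y. \<phi> x y = Some 1} \<restriction> h x))"

lemma hyperavoidable_iff:
  "hyperavoidable \<phi> A \<longleftrightarrow>
    (\<exists>h. order_function h \<and> (\<forall>x. \<exists>y<h x. \<phi> x y \<noteq> Some (of_bool (y \<in> A))))"
proof -
  have "({..<n} \<subseteq> {y. f y \<in> {Some 0, Some 1}} \<longrightarrow> A \<restriction> n \<noteq> {y. f y = Some 1} \<restriction> n) \<longleftrightarrow>
      (\<exists>y<n. f y \<noteq> Some (of_bool (y \<in> A)))" for n and f :: "nat \<rightharpoonup> nat"
  proof -
    have "({..<n} \<subseteq> {y. f y \<in> {Some 0, Some 1}} \<and> A \<restriction> n = {y. f y = Some 1} \<restriction> n) \<longleftrightarrow>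
        (\<forall>y<n. f y \<in> {Some 0, Some 1} \<and> (y \<in> A \<longleftrightarrow> f y = Some 1))"
      by (auto simp: initial_segment_def)
    also have "\<dots> \<longleftrightarrow> (\<forall>y<n. f y = Some (of_bool (y \<in> A)))"
      by (auto simp: of_bool_def)
    finally show ?thesis
      by blast
  qed
  then show ?thesis
    unfolding hyperavoidable_def by simp
qed

end

theory Submission
  imports Defs
begin

text \<open>
  If \<open>A\<close> is complex with bound \<open>g\<close>, let \<open>h z\<close> be the least \<open>n\<close> with \<open>z < g n\<close>.  A machine that maps
  the \<open>z\<close>-th string to \<open>\<phi>\<^bsub>e z\<^esub> \<restriction> h z\<close> shows that \<open>A \<restriction> h z\<close> could agree with \<open>\<phi>\<^bsub>e z\<^esub>\<close> only if
  \<open>z < log z + c\<close>, which bounds \<open>z\<close>.  If \<open>e\<close> takes every value \<open>x\<close> at some large argument \<open>z\<close>,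
  increasing in \<open>x\<close>, then \<open>x \<mapsto> h z\<close> witnesses hyperavoidability.

  Conversely, acceptability translates a program \<open>p\<close> recursively into an index \<open>f p\<close> of the
  function listing the bits of \<open>U p\<close>.  If \<open>U p = A \<restriction> y\<close>, hyperavoidability gives \<open>y < h (f p)\<close>, so
  \<open>y\<close> is bounded by a recursive function \<open>H\<close> of the length of \<open>p\<close>, and the inverse of \<open>H\<close> is a
  lower bound for the complexity.
\<close>

section \<open>Closure properties of the recursive functions\<close>

abbreviation total_recursive :: "nat \<Rightarrow> (nat list \<Rightarrow> nat) \<Rightarrow> bool" where
  "total_recursive k F \<equiv> partial_recursive k (\<lambda>xs. Some (F xs))"

lemma partial_recursive_subst:
  assumes "partial_recursive (length Fs) f" and "\<And>F. F \<in> set Fs \<Longrightarrow> total_recursive k F"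
  shows "partial_recursive k (\<lambda>xs. f (map (\<lambda>F. F xs) Fs))"
proof -
  let ?gs = "map (\<lambda>F xs. Some (F xs)) Fs"
  have "partial_recursive (length ?gs) f" "\<forall>g\<in>set ?gs. partial_recursive k g"
    using assms by auto
  from partial_recursive.comp[OF this] show ?thesis
    by (rule partial_recursive.ext) (auto simp: comp_def)
qed

text \<open>Composing \<open>f\<close> with \<open>N\<close> and the \<open>k\<close> projections
  prepends the value of \<open>N\<close> to the arguments; strictness of composition is what
  \<open>Option.bind\<close> expresses.\<close>

lemma partial_recursive_bind:
  assumes "partial_recursive k N" and "partial_recursive (Suc k) f"
  shows "partial_recursive k (\<lambda>xs. Option.bind (N xs) (\<lambda>a. f (a # xs)))"
proof -
  let ?gs = "N # map (\<lambda>i xs. Some (xs ! i)) [0..<k]"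
  have "partial_recursive (length ?gs) f" "\<forall>g\<in>set ?gs. partial_recursive k g"
    using assms by (auto intro: partial_recursive.proj)
  from partial_recursive.comp[OF this] show ?thesis
  proof (rule partial_recursive.ext)
    fix xs :: "nat list"
    assume "length xs = k"
    then have "map (\<lambda>g. the (g xs)) (map (\<lambda>i xs. Some (xs ! i)) [0..<k]) = xs"
      by (auto simp: comp_def map_nth)
    then show "(if \<exists>g\<in>set ?gs. g xs = None then None else f (map (\<lambda>g. the (g xs)) ?gs)) =
        Option.bind (N xs) (\<lambda>a. f (a # xs))"
      by (cases "N xs") auto
  qed
qed

text \<open>Recursion and minimization push their variables onto the front of the argument list;
  this lets a function of the parameters alone be used beneath them.\<close>

lemma partial_recursive_tl:
  assumes "partial_recursive k f"
  shows "partial_recursive (Suc k) (\<lambda>xs. f (tl xs))"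
proof -
  let ?Fs = "map (\<lambda>i xs. xs ! Suc i) [0..<k]"
  have "partial_recursive (Suc k) (\<lambda>xs. f (map (\<lambda>F. F xs) ?Fs))"
    using assms by (intro partial_recursive_subst) (auto intro: partial_recursive.proj)
  then show ?thesis
  proof (rule partial_recursive.ext)
    fix xs :: "nat list"
    assume "length xs = Suc k"
    then have "map (\<lambda>F. F xs) ?Fs = tl xs"
      by (intro nth_equalityI) (auto simp: nth_tl)
    then show "f (map (\<lambda>F. F xs) ?Fs) = f (tl xs)"
      by simp
  qed
qed

lemma partial_recursive_tl2:
  "partial_recursive k f \<Longrightarrow> partial_recursive (Suc (Suc k)) (\<lambda>xs. f (tl (tl xs)))"
  by (rule partial_recursive_tl[OF partial_recursive_tl])

lemma total_recursive_Suc: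
  assumes "total_recursive k F"
  shows "total_recursive k (\<lambda>xs. Suc (F xs))"
  using partial_recursive_subst[of "[F]" "\<lambda>xs. Some (Suc (hd xs))" k] assms
    partial_recursive.succ by simp

lemma total_recursive_const: "total_recursive k (\<lambda>_. c)"
  by (induction c) (auto intro: partial_recursive.zero total_recursive_Suc)

lemma partial_recursive_rec_nat:
  assumes "partial_recursive k f" and "total_recursive k N"
    and "partial_recursive (Suc (Suc k)) g"
  shows "partial_recursive k
    (\<lambda>xs. rec_nat (f xs) (\<lambda>n r. Option.bind r (\<lambda>y. g (n # y # xs))) (N xs))"
  using partial_recursive_bind[OF assms(2) partial_recursive.prim_rec[OF assms(1,3)]] by simp

lemma total_recursive_rec_nat:
  assumes "total_recursive k F" and "total_recursive k N" and "total_recursive (Suc (Suc k)) G"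
  shows "total_recursive k (\<lambda>xs. rec_nat (F xs) (\<lambda>n r. G (n # r # xs)) (N xs))"
proof -
  have "rec_nat (Some a) (\<lambda>n r. Option.bind r (\<lambda>y. Some (G (n # y # xs)))) m =
      Some (rec_nat a (\<lambda>n r. G (n # r # xs)) m)" for a xs m
    by (induction m) auto
  with partial_recursive_rec_nat[OF assms] show ?thesis
    by simp
qed

lemma total_recursive_compose1:
  assumes "recursive f" and "total_recursive k F"
  shows "total_recursive k (\<lambda>xs. f (F xs))"
  using partial_recursive_subst[of "[F]" "\<lambda>xs. Some (f (xs ! 0))" k] assms
  by (simp add: recursive_def partial_recursive1_def)

lemma partial_recursive_compose2:
  assumes "partial_recursive2 \<psi>" and "total_recursive k F" and "total_recursive k G"
  shows "partial_recursive k (\<lambda>xs. \<psi> (F xs) (G xs))"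
proof -
  have "partial_recursive (length [F, G]) (\<lambda>xs. \<psi> (xs ! 0) (xs ! 1))"
    using assms(1) by (simp add: partial_recursive2_def numeral_2_eq_2)
  from partial_recursive_subst[OF this, of k] assms(2,3) show ?thesis
    by fastforce
qed

lemma total_recursive_add:
  assumes "total_recursive k F" and "total_recursive k G"
  shows "total_recursive k (\<lambda>xs. F xs + G xs)"
proof -
  have "rec_nat a (\<lambda>n r. Suc r) m = a + m" for a m
    by (induction m) auto
  with total_recursive_rec_nat[OF assms, of "\<lambda>ys. Suc (ys ! 1)"] show ?thesis
    by (simp add: total_recursive_Suc partial_recursive.proj)
qed

lemma total_recursive_mult:
  assumes "total_recursive k F" and "total_recursive k G"
  shows "total_recursive k (\<lambda>xs. F xs * G xs)"
proof -
  have "rec_nat 0 (\<lambda>n r. r + a) m = a * m" for a m :: nat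
    by (induction m) auto
  with total_recursive_rec_nat[OF partial_recursive.zero assms(2),
      of "\<lambda>ys. ys ! 1 + F (tl (tl ys))"]
  show ?thesis
    by (simp add: total_recursive_add partial_recursive.proj partial_recursive_tl2[OF assms(1)])
qed

text \<open>A recursion that returns its counter and forgets its accumulator is the predecessor;
  iterating the predecessor gives truncated subtraction.\<close>

lemma total_recursive_diff:
  assumes "total_recursive k F" and "total_recursive k G"
  shows "total_recursive k (\<lambda>xs. F xs - G xs)"
proof -
  have "rec_nat 0 (\<lambda>n r. n) m = m - 1" for m :: nat
    by (cases m) auto
  then have pred: "total_recursive k (\<lambda>xs. F xs - 1)" if "total_recursive k F" for k F
    using total_recursive_rec_nat[OF partial_recursive.zero that, of "\<lambda>ys. ys ! 0"]
    by (simp add: partial_recursive.proj)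
  have "rec_nat a (\<lambda>n r. r - 1) m = a - m" for a m :: nat
    by (induction m) auto
  with total_recursive_rec_nat[OF assms, of "\<lambda>ys. ys ! 1 - 1"] pred show ?thesis
    by (simp add: partial_recursive.proj)
qed

lemma total_recursive_power:
  assumes "total_recursive k F" and "total_recursive k G"
  shows "total_recursive k (\<lambda>xs. F xs ^ G xs)"
proof -
  have "rec_nat 1 (\<lambda>n r. r * a) m = a ^ m" for a m :: nat
    by (induction m) auto
  with total_recursive_rec_nat[OF total_recursive_const[of _ 1] assms(2),
      of "\<lambda>ys. ys ! 1 * F (tl (tl ys))"]
  show ?thesis
    by (simp add: total_recursive_mult partial_recursive.proj partial_recursive_tl2[OF assms(1)])
qed

lemma total_recursive_sum:
  assumes "recursive f" and "total_recursive k N"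
  shows "total_recursive k (\<lambda>xs. \<Sum>i<N xs. f i)"
proof -
  have "rec_nat 0 (\<lambda>n r. r + f n) m = (\<Sum>i<m. f i)" for m
    by (induction m) auto
  with total_recursive_rec_nat[OF partial_recursive.zero assms(2), of "\<lambda>ys. ys ! 1 + f (ys ! 0)"]
  show ?thesis
    by (simp add: total_recursive_add total_recursive_compose1[OF assms(1)]
        partial_recursive.proj)
qed

text \<open>Minimization looks for a zero, and the truncated difference \<open>Suc F - G\<close>
  vanishes exactly where \<open>F < G\<close>.\<close>

lemma total_recursive_Least_less:
  assumes "total_recursive (Suc k) F" and "total_recursive (Suc k) G"
    and "\<And>xs. length xs = k \<Longrightarrow> \<exists>n. F (n # xs) < G (n # xs)"
  shows "total_recursive k (\<lambda>xs. LEAST n. F (n # xs) < G (n # xs))"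
proof -
  have "total_recursive (Suc k) (\<lambda>xs. Suc (F xs) - G xs)"
    using assms(1,2) by (intro total_recursive_diff total_recursive_Suc)
  from partial_recursive.minimization[OF this] show ?thesis
  proof (rule partial_recursive.ext)
    fix xs :: "nat list"
    assume "length xs = k"
    then have "\<exists>n. Suc (F (n # xs)) - G (n # xs) = 0"
      using assms(3) by (metis Suc_leI diff_is_0_eq)
    then show "mu (\<lambda>n. Some (Suc (F (n # xs)) - G (n # xs))) =
        Some (LEAST n. F (n # xs) < G (n # xs))"
      by (simp add: mu_def Suc_le_eq)
  qed
qed

lemma total_recursive_div:
  assumes "total_recursive k F" and "total_recursive k G"
    and pos: "\<And>xs. length xs = k \<Longrightarrow> 0 < G xs"
  shows "total_recursive k (\<lambda>xs. F xs div G xs)"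
proof -
  have "total_recursive k (\<lambda>xs. LEAST n. F (tl (n # xs)) < Suc ((n # xs) ! 0) * G (tl (n # xs)))"
  proof (rule total_recursive_Least_less)
    show "total_recursive (Suc k) (\<lambda>xs. F (tl xs))"
      by (rule partial_recursive_tl[OF assms(1)])
    show "total_recursive (Suc k) (\<lambda>xs. Suc (xs ! 0) * G (tl xs))"
      by (intro total_recursive_mult total_recursive_Suc partial_recursive.proj
          partial_recursive_tl[OF assms(2)]) simp
    show "\<exists>n. F (tl (n # xs)) < Suc ((n # xs) ! 0) * G (tl (n # xs))" if "length xs = k" for xs
      using pos[OF that] dividend_less_times_div[of "G xs" "F xs"]
      by (auto simp: algebra_simps intro: exI[of _ "F xs div G xs"])
  qed
  then show ?thesis
  proof (rule partial_recursive.ext)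
    fix xs :: "nat list"
    assume "length xs = k"
    then have *: "F xs < Suc n * G xs \<longleftrightarrow> F xs div G xs \<le> n" for n
      using pos by (metis div_less_iff_less_mult less_Suc_eq_le)
    show "Some (LEAST n. F (tl (n # xs)) < Suc ((n # xs) ! 0) * G (tl (n # xs))) =
        Some (F xs div G xs)"
      unfolding list.sel nth_Cons_0 * by (simp add: Least_equality)
  qed
qed

lemma total_recursive_mod:
  assumes "total_recursive k F" and "total_recursive k G"
    and "\<And>xs. length xs = k \<Longrightarrow> 0 < G xs"
  shows "total_recursive k (\<lambda>xs. F xs mod G xs)"
  unfolding minus_mult_div_eq_mod[symmetric]
  using assms by (intro total_recursive_diff total_recursive_mult total_recursive_div)

lemmas total_recursive_intros =
  partial_recursive.proj total_recursive_const total_recursive_Suc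
  total_recursive_add total_recursive_mult total_recursive_diff total_recursive_power
  total_recursive_div total_recursive_mod total_recursive_sum

lemma recursiveI: "total_recursive 1 (\<lambda>xs. f (xs ! 0)) \<Longrightarrow> recursive f"
  by (simp add: recursive_def partial_recursive1_def)

lemma recursive_Least_less:
  assumes "recursive g" and "\<And>y. \<exists>n. y < g n"
  shows "recursive (\<lambda>y. LEAST n. y < g n)"
proof (rule recursiveI)
  have "total_recursive 1 (\<lambda>xs. LEAST n. (n # xs) ! 1 < g ((n # xs) ! 0))"
    using assms(2)
    by (intro total_recursive_Least_less[where F = "\<lambda>xs. xs ! 1" and G = "\<lambda>xs. g (xs ! 0)"]
        total_recursive_compose1[OF assms(1)] partial_recursive.proj) auto
  then show "total_recursive 1 (\<lambda>xs. LEAST n. xs ! 0 < g n)"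
    by simp
qed

section \<open>String codes\<close>

lemma string_code_Nil [simp]: "string_code [] = 0"
  by (simp add: string_code_def)

lemma string_code_snoc [simp]: "string_code (w @ [b]) = 2 * string_code w + 1 + of_bool b"
  by (simp add: string_code_def)

text \<open>In binary, \<open>Suc (string_code w)\<close> is \<open>1w\<close>, a number of
  \<open>length w + 1\<close> digits.\<close>

lemma string_code_bounds:
  "2 ^ length w \<le> Suc (string_code w)" "Suc (string_code w) < 2 ^ Suc (length w)"
  by (induction w rule: rev_induct) auto

text \<open>Division by a power of two deletes the digits of \<open>v\<close> from the end of the
  binary notation \<open>1uv\<close>.\<close>

lemma string_code_append_div: "Suc (string_code (u @ v)) div 2 ^ length v = Suc (string_code u)"
proof (induction v rule: rev_induct)
  case (snoc b v)
  have "Suc (string_code (u @ v @ [b])) div 2 = Suc (string_code (u @ v))"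
    using string_code_snoc[of "u @ v" b] by (cases b) auto
  with snoc show ?case
    by (simp add: div_mult2_eq)
qed simp

text \<open>
  The binary notation of \<open>s + 1\<close> has a leading \<open>1\<close>, so the bit with index \<open>n\<close> is the last one of
  the prefix of length \<open>n + 2\<close>.
\<close>
definition code_bit :: "nat \<Rightarrow> nat \<Rightarrow> nat" where
  "code_bit s n = Suc s div 2 ^ (LEAST k. Suc s < 2 ^ (n + 2 + k)) mod 2"

lemma code_bit_string_code:
  assumes "n < length w"
  shows "code_bit (string_code w) n = of_bool (w ! n)"
proof -
  let ?m = "length w - Suc n"
  \<comment> \<open>The search therefore finds the number of digits that follow the bit with index
    \<open>n\<close>, and the division in \<open>code_bit\<close> deletes exactly those.\<close>
  have "Suc (string_code w) < 2 ^ (n + 2 + k) \<longleftrightarrow> ?m \<le> k" for k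
  proof
    assume "Suc (string_code w) < 2 ^ (n + 2 + k)"
    with string_code_bounds(1)[of w] have "(2::nat) ^ length w < 2 ^ (n + 2 + k)"
      by linarith
    then have "length w < n + 2 + k"
      by (rule power_less_imp_less_exp[rotated]) simp
    then show "?m \<le> k"
      by simp
  next
    assume "?m \<le> k"
    with assms have "(2::nat) ^ Suc (length w) \<le> 2 ^ (n + 2 + k)"
      by (intro power_increasing) auto
    with string_code_bounds(2)[of w] show "Suc (string_code w) < 2 ^ (n + 2 + k)"
      by linarith
  qed
  then have "(LEAST k. Suc (string_code w) < 2 ^ (n + 2 + k)) = ?m"
    by (simp add: Least_equality)
  moreover have "Suc (string_code w) div 2 ^ ?m = Suc (string_code (take n w @ [w ! n]))"
    using string_code_append_div[of "take (Suc n) w" "drop (Suc n) w"] assms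
    by (metis append_take_drop_id length_drop take_Suc_conv_app_nth)
  ultimately show ?thesis
    by (simp add: code_bit_def)
qed

lemma partial_recursive2_code_bit: "partial_recursive2 (\<lambda>s n. Some (code_bit s n))"
proof -
  have "total_recursive 2
      (\<lambda>xs. LEAST k. Suc ((k # xs) ! 1) < 2 ^ ((k # xs) ! 2 + 2 + (k # xs) ! 0))"
  proof (rule total_recursive_Least_less[where F = "\<lambda>xs. Suc (xs ! 1)"
        and G = "\<lambda>xs. 2 ^ (xs ! 2 + 2 + xs ! 0)"])
    show "\<exists>k. Suc ((k # xs) ! 1) < 2 ^ ((k # xs) ! 2 + 2 + (k # xs) ! 0)" for xs :: "nat list"
    proof
      have "Suc a < 2 ^ (b + 2 + a)" for a b :: nat
        using less_exp[of "a + 1"] power_increasing[of "a + 1" "b + 2 + a" "2::nat"] by simp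
      then show "Suc ((xs ! 0 # xs) ! 1) < 2 ^ ((xs ! 0 # xs) ! 2 + 2 + (xs ! 0 # xs) ! 0)"
        by simp
    qed
  qed (intro total_recursive_intros; simp)+
  then have "total_recursive 2 (\<lambda>xs. LEAST k. Suc (xs ! 0) < 2 ^ (xs ! 1 + 2 + k))"
    by simp
  then show ?thesis
    unfolding partial_recursive2_def code_bit_def by (intro total_recursive_intros) simp_all
qed

lemma length_initial_segment [simp]: "length (A \<restriction> n) = n"
  by (simp add: initial_segment_def)

lemma nth_initial_segment [simp]: "i < n \<Longrightarrow> (A \<restriction> n) ! i \<longleftrightarrow> i \<in> A"
  by (simp add: initial_segment_def)

lemma initial_segment_Suc: "A \<restriction> Suc n = (A \<restriction> n) @ [n \<in> A]"
  by (simp add: initial_segment_def)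

section \<open>Complex sets are hyperavoidable\<close>

lemma plain_complexity_le: "U q = Some w \<Longrightarrow> plain_complexity U w \<le> length q"
  unfolding plain_complexity_def by (rule Least_le) auto

lemma plain_complexity_attained:
  assumes "universal_machine U"
  obtains p where "U p = Some w" "length p = plain_complexity U w"
  using universal_machine_surj[OF assms, of w]
    LeastI_ex[of "\<lambda>n. \<exists>p. U p = Some w \<and> length p = n"]
  unfolding plain_complexity_def by blast

text \<open>
  The code of the string with the bits \<open>f 0, \<dots>, f (n - 1)\<close>; values other than \<open>0\<close> and \<open>1\<close> are
  harmless, since every number is a code.
\<close>
definition prefix_code :: "(nat \<rightharpoonup> nat) \<Rightarrow> nat \<Rightarrow> nat option" where
  "prefix_code f n =
    rec_nat (Some 0) (\<lambda>i r. Option.bind r (\<lambda>s. map_option (\<lambda>b. 2 * s + 1 + b) (f i))) n"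

lemma prefix_code_initial_segment:
  assumes "\<And>i. i < n \<Longrightarrow> f i = Some (of_bool (i \<in> A))"
  shows "prefix_code f n = Some (string_code (A \<restriction> n))"
  using assms
proof (induction n)
  case (Suc n)
  then show ?case
    by (simp add: prefix_code_def initial_segment_Suc)
qed (simp add: prefix_code_def initial_segment_def)

lemma partial_recursive_prefix_code:
  assumes "partial_recursive2 \<phi>" and "recursive e" and "recursive h"
  shows "partial_recursive1 (\<lambda>z. prefix_code (\<phi> (e z)) (h z))"
proof -
  \<comment> \<open>The arguments are the counter, the code built so far and \<open>z\<close>.
    Binding the bit \<open>b\<close> prepends it, which moves the code to index 2.\<close>
  have "partial_recursive 3 (\<lambda>xs. \<phi> (e (xs ! 2)) (xs ! 0))"
    by (intro partial_recursive_compose2[OF assms(1)] total_recursive_compose1[OF assms(2)]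
        partial_recursive.proj) simp_all
  moreover have "total_recursive (Suc 3) (\<lambda>ys. 2 * ys ! 2 + 1 + ys ! 0)"
    by (intro total_recursive_intros) simp_all
  ultimately have "partial_recursive 3
      (\<lambda>xs. Option.bind (\<phi> (e (xs ! 2)) (xs ! 0)) (\<lambda>b. Some (2 * xs ! 1 + 1 + b)))"
    using partial_recursive_bind by fastforce
  then have "partial_recursive (Suc (Suc 1))
      (\<lambda>xs. map_option (\<lambda>b. 2 * xs ! 1 + 1 + b) (\<phi> (e (xs ! 2)) (xs ! 0)))"
    by (simp add: map_conv_bind_option comp_def numeral_3_eq_3)
  from partial_recursive_rec_nat[OF partial_recursive.zero _ this, of "\<lambda>xs. h (xs ! 0)"] assms(3)
  show ?thesis
    by (simp add: partial_recursive1_def prefix_code_def recursive_def)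
qed

text \<open>Every number is a code, so decoding the values of \<psi> turns it into a machine, and
  \<open>c\<close> is the overhead of simulating that machine on \<open>U\<close>.\<close>

lemma universal_machine_simulates:
  assumes "universal_machine U" and "partial_recursive1 \<psi>"
  obtains c where "\<And>p w. \<psi> (string_code p) = Some (string_code w) \<Longrightarrow>
    plain_complexity U w \<le> length p + c"
proof -
  define M where "M p = map_option (inv string_code) (\<psi> (string_code p))" for p
  have "machine M"
    unfolding machine_def
  proof (intro exI conjI allI)
    show "\<psi> (string_code p) = map_option string_code (M p)" for p
      using bij_string_code
      by (simp add: M_def option.map_comp comp_def surj_f_inv_f bij_is_surj option.map_ident)
  qed (fact assms(2))
  then obtain c where c: "\<forall>p\<in>dom M. \<exists>q. U q = M p \<and> length q \<le> length p + c"
    using assms(1) unfolding universal_machine_def by blast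
  show thesis
  proof
    fix p w
    assume "\<psi> (string_code p) = Some (string_code w)"
    then have "M p = Some w"
      using bij_string_code by (simp add: M_def bij_is_inj)
    with c obtain q where "U q = Some w" "length q \<le> length p + c"
      by (metis domI)
    then show "plain_complexity U w \<le> length p + c"
      using plain_complexity_le order_trans by blast
  qed
qed

text \<open>Since \<open>2 * m\<close> \<le> \<open>2 ^ m\<close> \<le> \<open>z + 1\<close>,
  doubling the first assumption leaves a bound on \<open>z\<close> alone. In the application
  \<open>m\<close> is the length of the string with code \<open>z\<close>.\<close>

lemma less_logarithm_imp_bounded:
  assumes "z < m + c" and "2 ^ m \<le> Suc z"
  shows "z < 2 * c"
proof -
  have "2 * m \<le> 2 ^ m"
  proof (cases m)
    case (Suc n)
    show ?thesis
      unfolding Suc power_Suc using less_exp[of n] by (intro mult_le_mono2 Suc_leI)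
  qed simp
  with assms show ?thesis
    by linarith
qed

text \<open>
  Every value of this function is attained at arbitrarily large arguments, increasing with the
  value.
\<close>
definition square_excess :: "nat \<Rightarrow> nat" where
  "square_excess z = z - (LEAST r. z < Suc r * Suc r) * (LEAST r. z < Suc r * Suc r)"

lemma square_excess:
  assumes "x \<le> m"
  shows "square_excess (m * m + x) = x"
proof -
  \<comment> \<open>The search in \<open>square_excess\<close> computes the integer square root,
    which is \<open>m\<close> because \<open>x\<close> \<le> \<open>m\<close> keeps the argument
    below the next square.\<close>
  have "m * m + x < Suc r * Suc r \<longleftrightarrow> m \<le> r" for r
  proof
    assume *: "m * m + x < Suc r * Suc r"
    show "m \<le> r"
    proof (rule ccontr)
      assume "\<not> m \<le> r"
      then have "Suc r * Suc r \<le> m * m"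
        by (intro mult_mono) auto
      with * show False by simp
    qed
  next
    assume "m \<le> r"
    then have "Suc m * Suc m \<le> Suc r * Suc r"
      by (intro mult_mono) auto
    with assms show "m * m + x < Suc r * Suc r"
      by simp
  qed
  then have "(LEAST r. m * m + x < Suc r * Suc r) = m"
    by (simp add: Least_equality)
  then show ?thesis
    by (simp add: square_excess_def)
qed

lemma recursive_square_excess: "recursive square_excess"
proof -
  have root: "recursive (\<lambda>z. LEAST r. z < Suc r * Suc r)"
  proof (rule recursive_Least_less)
    show "recursive (\<lambda>r. Suc r * Suc r)"
      by (intro recursiveI total_recursive_intros) simp_all
    show "\<exists>r. y < Suc r * Suc r" for y
      by (rule exI[of _ y]) simp
  qed
  show ?thesis
    unfolding square_excess_def[abs_def]
    by (intro recursiveI total_recursive_intros total_recursive_compose1[OF root]) simp_all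
qed

lemma order_function_less:
  assumes "order_function g"
  shows "\<exists>n. y < g n"
  using assms unfolding order_function_def by (metis Suc_le_eq)

text \<open>This generalized inverse of \<open>g\<close> is unbounded because, by monotonicity,
  \<open>g b < g n\<close> forces \<open>b < n\<close>.\<close>

lemma order_function_Least_less:
  assumes "order_function g"
  shows "order_function (\<lambda>y. LEAST n. y < g n)"
proof -
  have less: "y < g (LEAST n. y < g n)" for y
    using order_function_less[OF assms] by (rule LeastI_ex)
  have "mono (\<lambda>y. LEAST n. y < g n)"
    using le_less_trans[OF _ less] by (intro monoI Least_le)
  moreover have "b \<le> (LEAST n. g b < g n)" for b
    using less[of "g b"] assms unfolding order_function_def
    by (meson leI less_imp_le_nat monoD not_le)
  ultimately show ?thesis
    using assms recursive_Least_less[OF _ order_function_less[OF assms]]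
    unfolding order_function_def by blast
qed

lemma complex_set_imp_hyperavoidable:
  assumes "partial_recursive2 \<phi>" and U: "universal_machine U" and "complex_set U A"
  shows "hyperavoidable \<phi> A"
proof -
  obtain g where g: "order_function g" and C: "\<And>y. g y \<le> plain_complexity U (A \<restriction> y)"
    using assms(3) unfolding complex_set_def by blast
  define h where "h z = (LEAST n. z < g n)" for z
  have h: "order_function h"
    using order_function_Least_less[OF g] by (simp add: h_def[abs_def])
  \<comment> \<open>The machine recovers the index from \<open>z\<close> itself and does not refer
    to \<open>e\<close>, so its constant \<open>c\<close> is available when \<open>e\<close> is
    chosen.\<close>
  have "partial_recursive1 (\<lambda>z. prefix_code (\<phi> (square_excess z)) (h z))"
    using assms(1) h
    by (intro partial_recursive_prefix_code recursive_square_excess)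
      (simp_all add: order_function_def)
  then obtain c where c: "\<And>p w. prefix_code (\<phi> (square_excess (string_code p)))
      (h (string_code p)) = Some (string_code w) \<Longrightarrow> plain_complexity U w \<le> length p + c"
    using universal_machine_simulates[OF U] by blast
  \<comment> \<open>The root \<open>x + 2 * c\<close> is at least \<open>x\<close>, so
    \<open>square_excess\<close> maps \<open>e x\<close> back to \<open>x\<close>; it is at least
    \<open>2 * c\<close>, so \<open>e x\<close> violates the bound \<open>e x < 2 * c\<close>
    derived below.\<close>
  define e where "e x = (x + 2 * c) * (x + 2 * c) + x" for x
  have rec_h: "recursive h"
    using h by (simp add: order_function_def)
  have "recursive (\<lambda>x. h (e x))"
    unfolding e_def
    by (intro recursiveI total_recursive_compose1[OF rec_h] total_recursive_intros) simp_all
  moreover have "mono (\<lambda>x. h (e x))"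
  proof (rule monoI)
    fix x y :: nat
    assume "x \<le> y"
    then have "e x \<le> e y"
      unfolding e_def by (intro add_mono mult_mono) auto
    then show "h (e x) \<le> h (e y)"
      using h unfolding order_function_def by (blast dest: monoD)
  qed
  moreover have "\<exists>x. b \<le> h (e x)" for b
  proof -
    obtain x where "b \<le> h x"
      using h unfolding order_function_def by blast
    moreover have "h x \<le> h (e x)"
      using h unfolding order_function_def e_def by (intro monoD[of h]) auto
    ultimately show ?thesis
      by (blast intro: order_trans)
  qed
  moreover have "\<exists>y<h (e x). \<phi> x y \<noteq> Some (of_bool (y \<in> A))" for x
  proof (rule ccontr)
    assume "\<not> ?thesis"
    then have "prefix_code (\<phi> x) (h (e x)) = Some (string_code (A \<restriction> h (e x)))"
      by (intro prefix_code_initial_segment) blast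
    moreover obtain p where p: "string_code p = e x"
      using bij_string_code by (metis bij_is_surj surjD)
    moreover have "square_excess (e x) = x"
      unfolding e_def by (rule square_excess) simp
    ultimately have "plain_complexity U (A \<restriction> h (e x)) \<le> length p + c"
      using c[of p] by simp
    moreover have "e x < g (h (e x))"
      unfolding h_def using order_function_less[OF g] by (rule LeastI_ex)
    ultimately have "e x < length p + c"
      using C[of "h (e x)"] by linarith
    then have "e x < 2 * c"
      using string_code_bounds(1)[of p] by (intro less_logarithm_imp_bounded) (simp_all add: p)
    moreover have "2 * c \<le> (x + 2 * c) * (x + 2 * c)"
      by (rule order_trans[OF _ le_square]) simp
    ultimately show False
      by (simp add: e_def)
  qed
  ultimately show ?thesis
    unfolding hyperavoidable_iff order_function_def by (intro exI[of _ "\<lambda>x. h (e x)"]) blast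
qed

section \<open>Hyperavoidable sets are complex\<close>

lemma acceptable_numbering_program_bits:
  assumes "acceptable_numbering \<phi>" and "machine U"
  obtains f where "recursive f"
    and "\<And>p w n. U p = Some w \<Longrightarrow> n < length w \<Longrightarrow>
      \<phi> (f (string_code p)) n = Some (of_bool (w ! n))"
proof -
  obtain u where u: "partial_recursive1 u"
    and eq: "\<And>p. u (string_code p) = map_option string_code (U p)"
    using assms(2) unfolding machine_def by blast
  have "partial_recursive 2 (\<lambda>xs. u (xs ! 0))"
    using partial_recursive_subst[of "[\<lambda>xs. xs ! 0]" "\<lambda>xs. u (xs ! 0)" 2] u
    by (simp add: partial_recursive1_def partial_recursive.proj)
  \<comment> \<open>The arguments are the output code \<open>s\<close>, the program code and the bit
    index, hence the index 2.\<close>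
  moreover have "total_recursive (Suc 2) (\<lambda>xs. code_bit (xs ! 0) (xs ! 2))"
    by (intro partial_recursive_compose2[OF partial_recursive2_code_bit] partial_recursive.proj)
      simp_all
  ultimately have "partial_recursive 2
      (\<lambda>xs. Option.bind (u (xs ! 0)) (\<lambda>s. Some (code_bit s (xs ! 1))))"
    using partial_recursive_bind[of 2 "\<lambda>xs. u (xs ! 0)"
        "\<lambda>xs. Some (code_bit (xs ! 0) (xs ! 2))"] by simp
  then have "partial_recursive2 (\<lambda>z n. Option.bind (u z) (\<lambda>s. Some (code_bit s n)))"
    by (simp add: partial_recursive2_def)
  then obtain f where "recursive f"
    and \<phi>_f: "\<And>z. \<phi> (f z) = (\<lambda>n. Option.bind (u z) (\<lambda>s. Some (code_bit s n)))"
    using assms(1) unfolding acceptable_numbering_def by blast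
  show thesis
  proof
    fix p w n
    assume "U p = Some w" and "n < length w"
    then show "\<phi> (f (string_code p)) n = Some (of_bool (w ! n))"
      by (simp add: \<phi>_f eq code_bit_string_code)
  qed fact
qed

lemma hyperavoidable_imp_complex_set:
  assumes \<phi>: "acceptable_numbering \<phi>" and U: "universal_machine U" and "hyperavoidable \<phi> A"
  shows "complex_set U A"
proof -
  obtain h where h: "order_function h"
    and avoid: "\<And>x. \<exists>y<h x. \<phi> x y \<noteq> Some (of_bool (y \<in> A))"
    using assms(3) unfolding hyperavoidable_iff by blast
  have "machine U"
    using U by (simp add: universal_machine_def)
  then obtain f where f: "recursive f"
    and bits: "\<And>p w n. U p = Some w \<Longrightarrow> n < length w \<Longrightarrow>
      \<phi> (f (string_code p)) n = Some (of_bool (w ! n))"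
    using acceptable_numbering_program_bits[OF \<phi>] by blast
  \<comment> \<open>Strings shorter than \<open>n\<close> have codes below \<open>2 ^ n\<close>, and
    the sum dominates each of its terms. The summand \<open>n\<close> makes \<open>H\<close>
    unbounded.\<close>
  define H where "H n = n + (\<Sum>z<2 ^ n. h (f z))" for n
  have mono_H: "mono H"
    unfolding H_def
    by (intro monoI add_mono sum_mono2) (auto intro: less_le_trans power_increasing)
  have H: "y < H n" if "U p = Some (A \<restriction> y)" "length p < n" for p y n
  proof -
    obtain i where i: "i < h (f (string_code p))"
      "\<phi> (f (string_code p)) i \<noteq> Some (of_bool (i \<in> A))"
      using avoid by blast
    \<comment> \<open>At any position below \<open>y\<close> the function with index
      \<open>f (string_code p)\<close> outputs the bit of \<open>A\<close>, so a disagreement lies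
      at \<open>y\<close> or beyond.\<close>
    then have "y \<le> i"
      using bits[OF that(1), of i] by (intro leI notI) simp
    moreover have "string_code p < 2 ^ n"
      using string_code_bounds(2)[of p] power_increasing[of "Suc (length p)" n "2::nat"] that(2)
      by linarith
    then have "h (f (string_code p)) \<le> (\<Sum>z<2 ^ n. h (f z))"
      by (intro member_le_sum) auto
    ultimately show ?thesis
      using i(1) by (simp add: H_def)
  qed
  have rec_h: "recursive h"
    using h by (simp add: order_function_def)
  have rec_hf: "recursive (\<lambda>z. h (f z))"
    by (intro recursiveI total_recursive_compose1[OF rec_h] total_recursive_compose1[OF f]
        partial_recursive.proj) simp
  \<comment> \<open>The shift is needed because \<open>H n\<close> covers only programs of length
    less than \<open>n\<close>.\<close>
  have "recursive (\<lambda>n. H (Suc n))"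
    unfolding H_def
    by (intro recursiveI total_recursive_sum[OF rec_hf] total_recursive_intros) simp_all
  moreover have "mono (\<lambda>n. H (Suc n))"
    using mono_H by (simp add: mono_def)
  moreover have "b \<le> H (Suc b)" for b
    by (simp add: H_def)
  ultimately have "order_function (\<lambda>n. H (Suc n))"
    unfolding order_function_def by blast
  then have "order_function (\<lambda>y. LEAST n. y < H (Suc n))"
    by (rule order_function_Least_less)
  moreover have "(LEAST n. y < H (Suc n)) \<le> plain_complexity U (A \<restriction> y)" for y
  proof -
    obtain p where "U p = Some (A \<restriction> y)" "length p = plain_complexity U (A \<restriction> y)"
      using plain_complexity_attained[OF U] by blast
    then show ?thesis
      using H by (intro Least_le) simp
  qed
  ultimately show ?thesis
    unfolding complex_set_def by (intro exI[of _ "\<lambda>y. LEAST n. y < H (Suc n)"]) blast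
qed

theorem theorem3p3:
  fixes \<phi> :: "nat \<Rightarrow> nat \<rightharpoonup> nat"
    and U :: "bool list \<rightharpoonup> bool list"
    and A :: "nat set"
  assumes "acceptable_numbering \<phi>"
    and "universal_machine U"
  shows "complex_set U A \<longleftrightarrow> hyperavoidable \<phi> A"
  using assms complex_set_imp_hyperavoidable hyperavoidable_imp_complex_set
  unfolding acceptable_numbering_def by blast

end
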